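(* Assume the nonresonance condition: the only function $u^h:N^+\to\mathbb{C}$ with $L^h u^h=0$ on $M^+$ and $u^h|_\gamma=0$ is $u^h=0$. For $\xi_\gamma:\gamma\to\mathbb{C}$ and an admissible extension $V^h$ of $\xi_\gamma$ put $$P^h\xi_\gamma := V^h-G^h\ast\big[(L^hV^h)\mathbf{1}_{M^+}\big]=G^h\ast\big[(L^hV^h)\mathbf{1}_{M^-}\big],\qquad P^h_\gamma\xi_\gamma:=(P^h\xi_\gamma)|_\gamma .$$ Then: (i) $P^h_\gamma\xi_\gamma$ is independent of the chosen admissible extension $V^h$ of $\xi_\gamma$. (ii) $P^h_\gamma$ is idempotent: $(P^h_\gamma)^2=P^h_\gamma$. (iii) $\xi_\gamma\in\operatorname{Im}P^h_\gamma$ if and only if there exists $u^h:N^+\to\mathbb{C}$ with $L^hu^h=0$ on $M^+$ and $u^h|_\gamma=\xi_\gamma$; in that case $(P^h\xi_\gamma)|_{N^+}=u^h$.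
   Context: Lattice and operator. Let $d\in\{2,3\}$, $h>0$, wavenumber $k>0$. Functions on the lattice $\Lambda_h=h\mathbb{Z}^d$ are indexed by $\mathbb{Z}^d$ (node $h\bm m\leftrightarrow\bm m$). The discrete Helmholtz operator is $$(L^hv)_{\bm m}=-\frac1{h^2}\sum_{\bm e\in\mathbb{Z}^d,\,|\bm e|_1=1}(v_{\bm m+\bm e}-v_{\bm m})-k^2v_{\bm m}.$$ Geometry. $\Omega_{\rm in}\subset\mathbb{R}^d$ is a bounded Lipschitz domain, $M^+=\{\bm m\in\mathbb{Z}^d: h\bm m\in\Omega_{\rm in}\}$, $M^-=\{\bm m\in\mathbb{Z}^d: h\bm m\notin\overline{\Omega_{\rm in}}\}$, and no lattice node lies on $\partial\Omega_{\rm in}$, so $\mathbb{Z}^d=M^+\sqcup M^-$. $N^\pm$ is the set of all nodes of the stencils of $L^h$ centred in $M^\pm$: $N^\pm=M^\pm\cup\{\bm m+\bm e:\bm m\in M^\pm,|\bm e|_1=1\}$. The boundary strip is $\gamma=N^+\cap N^-$, with $\gamma^\pm=\gamma\cap M^\pm$. $\mathbf{1}_A$ is the indicator of $A$. Lattice Green's function. $$G^h_{\bm m}=\frac1{(2\pi)^d}\int_{[-\pi,\pi]^d}\frac{e^{i\bm m\cdot\bm\theta}}{\sigma(\bm\theta)-k^2h^2+i0^+}\,d\bm\theta,\qquad \sigma(\bm\theta)=\sum_{j=1}^d2(1-\cos\theta_j),$$ where $i0^+$ means the limit $\varepsilon\to0^+$ with $i\varepsilon$ in place of $i0^+$; $(h,k)$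 are assumed such that the limit exists. Then $L^hG^h=h^{-2}\delta_{\bm 0}$. For finitely supported $f$, $(G^h\ast f)_{\bm m}=h^2\sum_{\bm n}G^h_{\bm m-\bm n}f_{\bm n}$, so $L^h(G^h\ast f)=f$; the function $G^h\ast f$ is called the outgoing solution generated by $f$. Admissible extension. $V^h:\mathbb{Z}^d\to\mathbb{C}$ is an admissible extension of $\xi_\gamma:\gamma\to\mathbb{C}$ if $V^h|_\gamma=\xi_\gamma$, $L^hV^h$ has finite support, and either $V^h$ is compactly (finitely) supported or $V^h=G^h\ast(L^hV^h)$. In both cases $G^h\ast L^hV^h=V^h$. *)

theory Defs
  imports "HOL-Analysis.Analysis"
begin

text \<open>
  The lattice \<open>h \<int>\<^sup>d\<close> is indexed by \<^typ>\<open>int ^ 'd\<close>, so that the dimension is \<open>CARD('d)\<close>.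
  A function on a set \<open>A\<close> of nodes is an element of \<open>A \<rightarrow>\<^sub>E UNIV\<close>, so equality of functions on
  \<open>A\<close> is HOL equality.
\<close>

definition unit_steps :: "(int ^ 'd) set" where
  "unit_steps = {e. (\<Sum>j\<in>UNIV. \<bar>e $ j\<bar>) = 1}"

definition discrete_helmholtz ::
    "real \<Rightarrow> real \<Rightarrow> (int ^ 'd \<Rightarrow> complex) \<Rightarrow> int ^ 'd \<Rightarrow> complex" where
  "discrete_helmholtz h k v m =
     - (1 / of_real h ^ 2) * (\<Sum>e\<in>unit_steps. v (m + e) - v m) - of_real k ^ 2 * v m"

text \<open>
  Near each boundary point the domain is, for some unit direction \<open>\<nu>\<close>, the strict subgraph of a
  Lipschitz function on the hyperplane orthogonal to \<open>\<nu>\<close>.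
\<close>

definition lipschitz_domain :: "'a::euclidean_space set \<Rightarrow> bool" where
  "lipschitz_domain \<Omega> \<longleftrightarrow> open \<Omega> \<and> connected \<Omega> \<and> \<Omega> \<noteq> {} \<and>
     (\<forall>x\<in>frontier \<Omega>. \<exists>\<nu> r C \<phi>. norm \<nu> = 1 \<and> r > 0 \<and> C-lipschitz_on {z. z \<bullet> \<nu> = 0} \<phi> \<and>
        \<Omega> \<inter> ball x r = {y \<in> ball x r. y \<bullet> \<nu> < \<phi> (y - (y \<bullet> \<nu>) *\<^sub>R \<nu>)})"

definition node :: "real \<Rightarrow> int ^ 'd \<Rightarrow> real ^ 'd" where
  "node h m = (\<chi> i. h * real_of_int (m $ i))"

definition M_plus :: "real \<Rightarrow> (real ^ 'd) set \<Rightarrow> (int ^ 'd) set" where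
  "M_plus h \<Omega> = {m. node h m \<in> \<Omega>}"

definition M_minus :: "real \<Rightarrow> (real ^ 'd) set \<Rightarrow> (int ^ 'd) set" where
  "M_minus h \<Omega> = {m. node h m \<notin> closure \<Omega>}"

definition stencil_nodes :: "(int ^ 'd) set \<Rightarrow> (int ^ 'd) set" where
  "stencil_nodes M = M \<union> {m + e | m e. m \<in> M \<and> e \<in> unit_steps}"

definition N_plus :: "real \<Rightarrow> (real ^ 'd) set \<Rightarrow> (int ^ 'd) set" where
  "N_plus h \<Omega> = stencil_nodes (M_plus h \<Omega>)"

definition N_minus :: "real \<Rightarrow> (real ^ 'd) set \<Rightarrow> (int ^ 'd) set" where
  "N_minus h \<Omega> = stencil_nodes (M_minus h \<Omega>)"

definition boundary_strip :: "real \<Rightarrow> (real ^ 'd) set \<Rightarrow> (int ^ 'd) set" where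
  "boundary_strip h \<Omega> = N_plus h \<Omega> \<inter> N_minus h \<Omega>"

definition lattice_symbol :: "real ^ 'd \<Rightarrow> real" where
  "lattice_symbol \<theta> = (\<Sum>j\<in>UNIV. 2 * (1 - cos (\<theta> $ j)))"

definition green_reg :: "real \<Rightarrow> real \<Rightarrow> real \<Rightarrow> int ^ 'd \<Rightarrow> complex" where
  "green_reg h k \<epsilon> m = 1 / of_real ((2 * pi) ^ CARD('d)) *
     integral (cbox (\<chi> i. - pi) (\<chi> i. pi))
       (\<lambda>\<theta> :: real ^ 'd. exp (\<i> * of_real (\<Sum>j\<in>UNIV. real_of_int (m $ j) * \<theta> $ j)) /
          (of_real (lattice_symbol \<theta> - k\<^sup>2 * h\<^sup>2) + \<i> * of_real \<epsilon>))"

text \<open>The Green's function, a limit \<open>\<epsilon> \<rightarrow> 0+\<close>, is meaningful only under \<open>green_exists\<close>.\<close>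

definition green_exists :: "real \<Rightarrow> real \<Rightarrow> 'd::finite itself \<Rightarrow> bool" where
  "green_exists h k _ \<longleftrightarrow>
     (\<forall>m :: int ^ 'd. \<exists>l. ((\<lambda>\<epsilon>. green_reg h k \<epsilon> m) \<longlongrightarrow> l) (at_right 0))"

definition green :: "real \<Rightarrow> real \<Rightarrow> int ^ 'd \<Rightarrow> complex" where
  "green h k m = Lim (at_right 0) (\<lambda>\<epsilon>. green_reg h k \<epsilon> m)"

definition finitely_supported :: "(int ^ 'd \<Rightarrow> complex) \<Rightarrow> bool" where
  "finitely_supported f \<longleftrightarrow> finite {m. f m \<noteq> 0}"

text \<open>Only used for finitely supported \<open>f\<close>.\<close>

definition green_conv ::
    "real \<Rightarrow> real \<Rightarrow> (int ^ 'd \<Rightarrow> complex) \<Rightarrow> int ^ 'd \<Rightarrow> complex" where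
  "green_conv h k f m = of_real h ^ 2 * (\<Sum>n | f n \<noteq> 0. green h k (m - n) * f n)"

definition admissible_extension ::
    "real \<Rightarrow> real \<Rightarrow> (real ^ 'd) set \<Rightarrow> (int ^ 'd \<Rightarrow> complex) \<Rightarrow> (int ^ 'd \<Rightarrow> complex) \<Rightarrow> bool" where
  "admissible_extension h k \<Omega> \<xi> V \<longleftrightarrow>
     (\<forall>m\<in>boundary_strip h \<Omega>. V m = \<xi> m) \<and>
     finitely_supported (discrete_helmholtz h k V) \<and>
     (finitely_supported V \<or> V = green_conv h k (discrete_helmholtz h k V))"

text \<open>
  The potential \<open>P\<^sup>h \<xi>\<close> is a function of the admissible extension \<open>V\<close> that is used to compute it:
  off \<open>N\<^sup>+\<close> its values may depend on the choice of \<open>V\<close>.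
\<close>

definition potential ::
    "real \<Rightarrow> real \<Rightarrow> (real ^ 'd) set \<Rightarrow> (int ^ 'd \<Rightarrow> complex) \<Rightarrow> int ^ 'd \<Rightarrow> complex" where
  "potential h k \<Omega> V =
     (\<lambda>m. V m - green_conv h k (\<lambda>n. discrete_helmholtz h k V n * indicator (M_plus h \<Omega>) n) m)"

text \<open>
  The projection is computed with some admissible extension (one always exists, see
  \<open>admissible_extension_exists\<close> below); the choice is immaterial once independence is known.
\<close>

definition boundary_projection ::
    "real \<Rightarrow> real \<Rightarrow> (real ^ 'd) set \<Rightarrow> (int ^ 'd \<Rightarrow> complex) \<Rightarrow> (int ^ 'd \<Rightarrow> complex)" where
  "boundary_projection h k \<Omega> \<xi> =
     restrict (potential h k \<Omega> (SOME V. admissible_extension h k \<Omega> \<xi> V)) (boundary_strip h \<Omega>)"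

definition nonresonant :: "real \<Rightarrow> real \<Rightarrow> (real ^ 'd) set \<Rightarrow> bool" where
  "nonresonant h k \<Omega> \<longleftrightarrow>
     (\<forall>u \<in> N_plus h \<Omega> \<rightarrow>\<^sub>E UNIV.
        (\<forall>m\<in>M_plus h \<Omega>. discrete_helmholtz h k u m = 0) \<and> (\<forall>m\<in>boundary_strip h \<Omega>. u m = 0)
        \<longrightarrow> (\<forall>m\<in>N_plus h \<Omega>. u m = 0))"

lemma finite_int_box: "finite {m :: int ^ 'd. \<forall>i. \<bar>m $ i\<bar> \<le> B}"
proof -
  have "m \<in> vec_lambda ` ((UNIV :: 'd set) \<rightarrow>\<^sub>E {- B..B})" if "\<forall>i. \<bar>m $ i\<bar> \<le> B" for m :: "int ^ 'd"
  proof
    show "m = vec_lambda (vec_nth m)" by simp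
    show "vec_nth m \<in> (UNIV :: 'd set) \<rightarrow>\<^sub>E {- B..B}"
      using that by (auto simp: abs_le_iff PiE_iff minus_le_iff)
  qed
  then have "{m :: int ^ 'd. \<forall>i. \<bar>m $ i\<bar> \<le> B} \<subseteq> vec_lambda ` ((UNIV :: 'd set) \<rightarrow>\<^sub>E {- B..B})"
    by blast
  then show ?thesis
    by (rule finite_subset) (intro finite_imageI finite_PiE, auto)
qed

lemma finite_unit_steps: "finite (unit_steps :: (int ^ 'd) set)"
proof (rule finite_subset[OF _ finite_int_box[of 1]])
  show "unit_steps \<subseteq> {m :: int ^ 'd. \<forall>i. \<bar>m $ i\<bar> \<le> 1}"
  proof (clarsimp simp: unit_steps_def)
    fix e :: "int ^ 'd" and i
    assume "(\<Sum>j\<in>UNIV. \<bar>e $ j\<bar>) = 1"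
    then show "\<bar>e $ i\<bar> \<le> 1"
      using member_le_sum[of i UNIV "\<lambda>j. \<bar>e $ j\<bar>"] by simp
  qed
qed

lemma finite_stencil_nodes:
  assumes "finite M"
  shows "finite (stencil_nodes M)"
proof -
  have "stencil_nodes M = M \<union> (\<lambda>(m, e). m + e) ` (M \<times> unit_steps)"
    by (auto simp: stencil_nodes_def)
  then show ?thesis
    using assms finite_unit_steps by auto
qed

lemma finite_M_plus:
  fixes \<Omega> :: "(real ^ 'd) set"
  assumes "h > 0" "bounded \<Omega>"
  shows "finite (M_plus h \<Omega>)"
proof -
  obtain B where B: "norm x \<le> B" if "x \<in> \<Omega>" for x
    using assms(2) by (auto simp: bounded_iff)
  show ?thesis
  proof (rule finite_subset[OF _ finite_int_box[of "\<lceil>B / h\<rceil>"]], clarsimp simp: M_plus_def)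
    fix m :: "int ^ 'd" and i
    assume "node h m \<in> \<Omega>"
    then have "\<bar>node h m $ i\<bar> \<le> B"
      using B component_le_norm_cart[of "node h m" i] by fastforce
    then have "h * real_of_int \<bar>m $ i\<bar> \<le> B"
      using assms(1) by (simp add: node_def abs_mult)
    then have "real_of_int \<bar>m $ i\<bar> \<le> B / h"
      using assms(1) by (simp add: field_simps)
    then show "\<bar>m $ i\<bar> \<le> \<lceil>B / h\<rceil>"
      by linarith
  qed
qed

lemma admissible_extension_exists:
  fixes \<Omega> :: "(real ^ 'd) set"
  assumes "h > 0" "bounded \<Omega>"
  shows "\<exists>V. admissible_extension h k \<Omega> \<xi> V"
proof
  let ?V = "\<lambda>m. if m \<in> boundary_strip h \<Omega> then \<xi> m else 0"
  have fin: "finite (boundary_strip h \<Omega>)"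
    unfolding boundary_strip_def N_plus_def
    using finite_stencil_nodes[OF finite_M_plus[OF assms]] by blast
  let ?T = "boundary_strip h \<Omega> \<union> (\<lambda>(m, e). m - e) ` (boundary_strip h \<Omega> \<times> unit_steps)"
  have "discrete_helmholtz h k ?V m = 0" if "m \<notin> ?T" for m
  proof -
    have "m + e \<notin> boundary_strip h \<Omega>" if "e \<in> unit_steps" for e
    proof
      assume "m + e \<in> boundary_strip h \<Omega>"
      with that have "(m + e) - e \<in> (\<lambda>(m, e). m - e) ` (boundary_strip h \<Omega> \<times> unit_steps)"
        by force
      with \<open>m \<notin> ?T\<close> show False by simp
    qed
    then show ?thesis
      using that by (simp add: discrete_helmholtz_def)
  qed
  then have "{m. discrete_helmholtz h k ?V m \<noteq> 0} \<subseteq> ?T" by blast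
  moreover have "finite ?T"
    using fin finite_unit_steps by auto
  ultimately have "finitely_supported (discrete_helmholtz h k ?V)"
    unfolding finitely_supported_def by (rule finite_subset)
  moreover have "finitely_supported ?V"
    unfolding finitely_supported_def by (rule finite_subset[OF _ fin]) auto
  ultimately show "admissible_extension h k \<Omega> \<xi> ?V"
    by (simp add: admissible_extension_def)
qed

end

theory Submission
  imports Defs
begin

text \<open>
  The operator multiplies the numerator of the regularised Green's function by
  \<open>(\<sigma> - k\<^sup>2 h\<^sup>2) / h\<^sup>2\<close>, so \<open>h\<^sup>2 L G\<^sub>\<epsilon> = \<delta> - \<i> \<epsilon> G\<^sub>\<epsilon>\<close>, and \<open>G\<close> is a fundamental solution whenever the limit
  exists. Hence \<open>G \<ast> L V = V\<close> for every admissible extension \<open>V\<close>.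

  The difference \<open>W\<close> of two admissible extensions of the same data vanishes on \<open>\<gamma>\<close>. Let \<open>U\<close> be \<open>W\<close> set
  to zero off \<open>N\<^sup>+\<close>. A stencil centred in \<open>M\<^sup>-\<close> meets \<open>N\<^sup>+\<close> only in \<open>\<gamma>\<close>, so \<open>L U\<close> is \<open>L W\<close> set to zero off
  \<open>M\<^sup>+\<close>; since \<open>U\<close> is finitely supported, convolution with \<open>G\<close> returns \<open>U\<close>, and the two potentials agree
  on all of \<open>N\<^sup>+\<close>. A solution \<open>u\<close> on \<open>N\<^sup>+\<close>, extended by zero, is an admissible extension of its trace
  whose potential is \<open>u\<close> on \<open>N\<^sup>+\<close>; conversely every potential solves the equation on \<open>M\<^sup>+\<close>. Idempotence
  and the description of the image follow.
\<close>

section \<open>Nearest-neighbour steps and plane waves\<close>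

text \<open>A nonzero integer coordinate has absolute value at least 1, so it exhausts the sum and
  all other coordinates vanish.\<close>

lemma unit_steps_eq:
  "unit_steps = (\<lambda>(j, s). axis j s) ` (UNIV \<times> {1, -1 :: int})"
proof (intro equalityI subsetI)
  fix e :: "int ^ 'd" assume "e \<in> unit_steps"
  then have e: "(\<Sum>j\<in>UNIV. \<bar>e $ j\<bar>) = 1" by (simp add: unit_steps_def)
  then obtain j where j: "e $ j \<noteq> 0"
    by (metis abs_zero sum.neutral zero_neq_one)
  have "(\<Sum>i\<in>UNIV. \<bar>e $ i\<bar>) = \<bar>e $ j\<bar> + (\<Sum>i\<in>UNIV - {j}. \<bar>e $ i\<bar>)"
    by (simp add: sum.remove)
  moreover have "(\<Sum>i\<in>UNIV - {j}. \<bar>e $ i\<bar>) \<ge> 0" by (simp add: sum_nonneg)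
  ultimately have "(\<Sum>i\<in>UNIV - {j}. \<bar>e $ i\<bar>) = 0" and abs: "\<bar>e $ j\<bar> = 1"
    using e j by linarith+
  then have "e $ i = 0" if "i \<noteq> j" for i
    using that by (simp add: sum_nonneg_eq_0_iff)
  then have "e = axis j (e $ j)" by (simp add: vec_eq_iff axis_def)
  moreover have "e $ j \<in> {1, -1}" using abs by auto
  ultimately show "e \<in> (\<lambda>(j, s). axis j s) ` (UNIV \<times> {1, -1})" by force
next
  fix e :: "int ^ 'd" assume "e \<in> (\<lambda>(j, s). axis j s) ` (UNIV \<times> {1, -1})"
  then obtain j s where "e = axis j s" and "\<bar>s\<bar> = 1" by force
  moreover from this have "\<bar>e $ i\<bar> = (if i = j then 1 else 0)" for i by (simp add: axis_def)
  ultimately show "e \<in> unit_steps" by (simp add: unit_steps_def)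
qed

lemma sum_unit_steps:
  fixes f :: "int ^ 'd \<Rightarrow> 'a::comm_monoid_add"
  shows "(\<Sum>e\<in>unit_steps. f e) = (\<Sum>j\<in>UNIV. f (axis j 1) + f (axis j (-1)))"
proof -
  \<comment> \<open>Injectivity rests on \<open>s\<close> being nonzero: \<open>axis j 0\<close> is
    the same vector for every \<open>j\<close>.\<close>
  have inj: "inj_on (\<lambda>(j :: 'd, s). axis j s) (UNIV \<times> {1, -1 :: int})"
    by (auto simp: inj_on_def axis_eq_axis)
  have "(\<Sum>e\<in>unit_steps. f e) = (\<Sum>(j, s)\<in>UNIV \<times> {1, -1}. f (axis j s))"
    unfolding unit_steps_eq by (subst sum.reindex[OF inj]) (simp add: case_prod_unfold)
  also have "\<dots> = (\<Sum>j\<in>UNIV. \<Sum>s\<in>{1, -1}. f (axis j s))"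
    by (rule sum.cartesian_product[symmetric])
  finally show ?thesis by simp
qed

text \<open>The numerator of the integrand in \<open>green_reg\<close>; for fixed \<theta> it is a
  character of the lattice, hence an eigenfunction of translations.\<close>

definition plane_wave :: "int ^ 'd \<Rightarrow> real ^ 'd \<Rightarrow> complex" where
  "plane_wave m \<theta> = exp (\<i> * of_real (\<Sum>j\<in>UNIV. real_of_int (m $ j) * \<theta> $ j))"

lemma plane_wave_add: "plane_wave (m + n) \<theta> = plane_wave m \<theta> * plane_wave n \<theta>"
  by (simp add: plane_wave_def distrib_right distrib_left sum.distrib exp_add)

lemma plane_wave_axis: "plane_wave (axis j s) \<theta> = cis (of_int s * \<theta> $ j)"
proof -
  have "(\<Sum>i\<in>UNIV. real_of_int (axis j s $ i) * \<theta> $ i) = (\<Sum>i\<in>UNIV. if i = j then of_int s * \<theta> $ i else 0)"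
    by (intro sum.cong) (auto simp: axis_def)
  then show ?thesis by (simp add: plane_wave_def cis_conv_exp)
qed

lemma plane_wave_prod: "plane_wave m \<theta> = (\<Prod>j\<in>UNIV. cis (of_int (m $ j) * \<theta> $ j))"
  by (simp add: plane_wave_def cis_conv_exp sum_distrib_left exp_sum)

text \<open>The two opposite steps along axis \<open>j\<close> together contribute the factor
  \<open>2 * cos (\<theta> $ j) - 2\<close>.\<close>

lemma sum_unit_steps_plane_wave:
  "(\<Sum>e\<in>unit_steps. plane_wave (m + e) \<theta> - plane_wave m \<theta>) =
     - of_real (lattice_symbol \<theta>) * plane_wave m \<theta>"
proof -
  have "(\<Sum>e\<in>unit_steps. plane_wave (m + e) \<theta> - plane_wave m \<theta>) =
      (\<Sum>j\<in>UNIV. (cis (\<theta> $ j) + cis (- \<theta> $ j) - 2) * plane_wave m \<theta>)"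
    by (simp add: sum_unit_steps plane_wave_add plane_wave_axis algebra_simps)
  also have "\<dots> = (\<Sum>j\<in>UNIV. - of_real (2 * (1 - cos (\<theta> $ j))) * plane_wave m \<theta>)"
    by (intro sum.cong refl arg_cong2[where f="(*)"]) (simp add: complex_eq_iff)
  finally show ?thesis
    by (simp only: lattice_symbol_def sum_distrib_right sum_negf of_real_sum mult_minus_left)
qed

lemma continuous_on_plane_wave [continuous_intros]: "continuous_on S (plane_wave m)"
  unfolding plane_wave_def by (intro continuous_intros)

lemma continuous_on_lattice_symbol [continuous_intros]: "continuous_on S lattice_symbol"
  unfolding lattice_symbol_def by (intro continuous_intros)

section \<open>Orthogonality of plane waves over a period cell\<close>

text \<open>For nonzero \<open>n\<close> the antiderivative is periodic and takes equal values at
  both endpoints.\<close>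

lemma integral_cis_period:
  "(LINT x:{-pi..pi}|lborel. cis (of_int n * x)) = (if n = 0 then 2 * pi else 0)"
proof (cases "n = 0")
  case True
  then show ?thesis
    by (simp add: set_lebesgue_integral_def measure_def scaleR_conv_of_real)
next
  case False
  have "((\<lambda>x. cis (of_int n * x) / (\<i> * of_int n)) has_vector_derivative cis (of_int n * x))
      (at x within {-pi..pi})" for x
  proof -
    have "((\<lambda>x. exp (\<i> * of_int n * of_real x) / (\<i> * of_int n)) has_vector_derivative
        exp (\<i> * of_int n * of_real x)) (at x within {-pi..pi})"
      using False by (auto intro!: derivative_eq_intros
          has_vector_derivative_real_field)
    then show ?thesis by (simp add: cis_conv_exp mult.assoc)
  qed
  then have "integral\<^sup>L lborel (\<lambda>x. indicator {-pi..pi} x *\<^sub>R cis (of_int n * x)) =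
      cis (of_int n * pi) / (\<i> * of_int n) - cis (of_int n * (- pi)) / (\<i> * of_int n)"
    by (intro integral_FTC_atLeastAtMost continuous_intros) auto
  moreover have "cis (of_int n * pi) = cis (of_int n * (- pi))"
    by (simp add: complex_eq_iff sin_int_times_real mult.commute)
  ultimately show ?thesis using False by (simp add: set_lebesgue_integral_def)
qed

text \<open>Lebesgue measure is the image of the product of one-dimensional measures under the
  coordinate map, so Fubini separates the factors.\<close>

lemma integral_lborel_prod:
  fixes f :: "'a::euclidean_space \<Rightarrow> real \<Rightarrow> 'b::{real_normed_field,banach,second_countable_topology}"
  assumes "\<And>b. b \<in> Basis \<Longrightarrow> integrable lborel (f b)"
  shows "(\<integral>x. (\<Prod>b\<in>Basis. f b (x \<bullet> b)) \<partial>lborel) = (\<Prod>b\<in>Basis. \<integral>x. f b x \<partial>lborel)"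
proof -
  interpret product_sigma_finite "\<lambda>_::'a. lborel :: real measure" ..
  have [measurable]: "f b \<in> borel_measurable borel" if "b \<in> Basis" for b
    using borel_measurable_integrable[OF assms[OF that]] by simp
  have "(\<integral>x. (\<Prod>b\<in>Basis. f b (x \<bullet> b)) \<partial>lborel) =
      (\<integral>y. (\<Prod>b\<in>Basis. f b (y b)) \<partial>(\<Pi>\<^sub>M b\<in>Basis. lborel))"
    by (subst lborel_eq, subst integral_distr) simp_all
  then show ?thesis by (simp add: product_integral_prod assms)
qed

text \<open>The integral factors into one-dimensional integrals over a period. This is the source of
  the delta in the equation for the Green's function.\<close>

lemma integral_plane_wave:
  "integral (cbox (\<chi> i. - pi) (\<chi> i. pi)) (plane_wave (m :: int ^ 'd)) =
     (if m = 0 then of_real ((2 * pi) ^ CARD('d)) else 0)"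
proof -
  let ?Q = "cbox (\<chi> i. - pi) (\<chi> i. pi) :: (real ^ 'd) set"
  \<comment> \<open>The index is a basis vector, as \<open>integral_lborel_prod\<close> requires;
    the inner sum recovers \<open>m $ j\<close> from \<open>b = axis j 1\<close>.\<close>
  define f where "f b x = indicator {-pi..pi} x *\<^sub>R cis ((\<Sum>j\<in>UNIV. of_int (m $ j) * b $ j) * x)"
    for b :: "real ^ 'd" and x
  have f_axis: "f (axis j 1) x = indicator {-pi..pi} x *\<^sub>R cis (of_int (m $ j) * x)" for j x
  proof -
    have "(\<Sum>i\<in>UNIV. of_int (m $ i) * (axis j 1 :: real ^ 'd) $ i) =
        (\<Sum>i\<in>UNIV. if i = j then of_int (m $ i) else (0 :: real))"
      by (intro sum.cong) (auto simp: axis_def)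
    then show ?thesis by (simp add: f_def)
  qed
  have prod_Basis: "(\<Prod>b\<in>Basis. g b) = (\<Prod>j\<in>UNIV. g (axis j 1))" for g :: "real ^ 'd \<Rightarrow> complex"
  proof -
    have "Basis = range (\<lambda>j :: 'd. axis j (1 :: real))" by (auto simp: Basis_vec_def)
    moreover have "inj (\<lambda>j :: 'd. axis j (1 :: real))" by (auto simp: inj_def axis_eq_axis)
    ultimately show ?thesis by (metis (no_types, lifting) comp_apply prod.cong prod.reindex)
  qed
  have "integral ?Q (plane_wave m) = (LINT \<theta>:?Q|lborel. plane_wave m \<theta>)"
    by (intro set_borel_integral_eq_integral(2)[symmetric])
      (auto simp: set_integrable_def intro!: borel_integrable_compact continuous_intros)
  also have "\<dots> = (\<integral>\<theta>. (\<Prod>b\<in>Basis. f b (\<theta> \<bullet> b)) \<partial>lborel)"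
    unfolding set_lebesgue_integral_def
  proof (intro Bochner_Integration.integral_cong refl)
    fix \<theta> :: "real ^ 'd"
    have "indicator ?Q \<theta> = (\<Prod>j\<in>UNIV. indicator {-pi..pi} (\<theta> $ j) :: real)"
      by (auto simp: mem_box_cart indicator_def prod_zero_iff)
    then show "indicator ?Q \<theta> *\<^sub>R plane_wave m \<theta> = (\<Prod>b\<in>Basis. f b (\<theta> \<bullet> b))"
      by (simp add: prod_Basis f_axis inner_axis plane_wave_prod scaleR_conv_of_real
          prod.distrib of_real_prod)
  qed
  also have "\<dots> = (\<Prod>b\<in>Basis. \<integral>x. f b x \<partial>lborel)"
    unfolding f_def
    by (intro integral_lborel_prod borel_integrable_compact continuous_intros) auto
  also have "\<dots> = (\<Prod>j\<in>UNIV. if m $ j = 0 then 2 * pi else 0)"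
    unfolding prod_Basis f_axis integral_cis_period[unfolded set_lebesgue_integral_def]
    by simp
  also have "\<dots> = (if m = 0 then of_real ((2 * pi) ^ CARD('d)) else 0)"
    by (auto simp: vec_eq_iff prod_zero_iff)
  finally show ?thesis .
qed

section \<open>The Green's function as a fundamental solution\<close>

lemma helmholtz_green_reg:
  fixes m :: "int ^ 'd"
  assumes "h \<noteq> 0" "\<epsilon> \<noteq> 0"
  shows "discrete_helmholtz h k (green_reg h k \<epsilon>) m =
    ((if m = 0 then 1 else 0) - \<i> * of_real \<epsilon> * green_reg h k \<epsilon> m) / of_real h ^ 2"
proof -
  let ?Q = "cbox (\<chi> i. - pi) (\<chi> i. pi) :: (real ^ 'd) set"
  define D where "D \<theta> = of_real (lattice_symbol \<theta> - k\<^sup>2 * h\<^sup>2) + \<i> * of_real \<epsilon>" for \<theta> :: "real ^ 'd"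
  define c where "c = 1 / complex_of_real ((2 * pi) ^ CARD('d))"
  have D0: "D \<theta> \<noteq> 0" for \<theta> using assms by (simp add: D_def complex_eq_iff)
  have reg: "green_reg h k \<epsilon> n = c * integral ?Q (\<lambda>\<theta>. plane_wave n \<theta> / D \<theta>)" for n :: "int ^ 'd"
    by (simp add: green_reg_def D_def c_def plane_wave_def)
  have cont_D: "continuous_on S D" for S
    unfolding D_def by (intro continuous_intros)
  have int: "(\<lambda>\<theta>. plane_wave n \<theta> / D \<theta>) integrable_on ?Q" for n :: "int ^ 'd"
    by (intro integrable_continuous continuous_intros cont_D) (simp add: D0)
  have "(\<Sum>e\<in>unit_steps. green_reg h k \<epsilon> (m + e) - green_reg h k \<epsilon> m) =
      c * integral ?Q (\<lambda>\<theta>. \<Sum>e\<in>unit_steps. plane_wave (m + e) \<theta> / D \<theta> - plane_wave m \<theta> / D \<theta>)"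
    by (subst integral_sum)
      (auto simp: finite_unit_steps int integrable_diff integral_diff reg sum_distrib_left algebra_simps)
  also have "(\<lambda>\<theta>. \<Sum>e\<in>unit_steps. plane_wave (m + e) \<theta> / D \<theta> - plane_wave m \<theta> / D \<theta>) =
      (\<lambda>\<theta>. (\<i> * of_real \<epsilon> - of_real (k\<^sup>2 * h\<^sup>2)) * (plane_wave m \<theta> / D \<theta>) - plane_wave m \<theta>)"
  proof
    fix \<theta>
    have "(\<Sum>e\<in>unit_steps. plane_wave (m + e) \<theta> / D \<theta> - plane_wave m \<theta> / D \<theta>) =
        - of_real (lattice_symbol \<theta>) * plane_wave m \<theta> / D \<theta>"
      by (simp only: sum_unit_steps_plane_wave[symmetric] sum_divide_distrib diff_divide_distrib)
    \<comment> \<open>The summand \<open>D \<theta>\<close> cancels the denominator and leaves a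
      bare plane wave, whose integral is the delta. The \<open>k\<^sup>2 * h\<^sup>2\<close> part
      later cancels the zeroth-order term of the operator.\<close>
    also have "of_real (lattice_symbol \<theta>) = D \<theta> - (\<i> * of_real \<epsilon> - of_real (k\<^sup>2 * h\<^sup>2))"
      by (simp add: D_def)
    finally show "(\<Sum>e\<in>unit_steps. plane_wave (m + e) \<theta> / D \<theta> - plane_wave m \<theta> / D \<theta>) =
        (\<i> * of_real \<epsilon> - of_real (k\<^sup>2 * h\<^sup>2)) * (plane_wave m \<theta> / D \<theta>) - plane_wave m \<theta>"
      using D0[of \<theta>] by (simp add: field_simps)
  qed
  also have "c * integral ?Q \<dots> = (\<i> * of_real \<epsilon> - of_real (k\<^sup>2 * h\<^sup>2)) * green_reg h k \<epsilon> m
      - c * integral ?Q (plane_wave m)"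
    by (subst integral_diff)
      (simp_all only: reg integrable_on_mult_right int integral_mult_right integrable_continuous
        continuous_on_plane_wave right_diff_distrib mult.left_commute)
  also have "c * integral ?Q (plane_wave m) = (if m = 0 then 1 else 0)"
    by (simp add: integral_plane_wave c_def)
  finally show ?thesis
    using assms by (simp add: discrete_helmholtz_def field_simps)
qed

text \<open>The stencil is finite, so the operator commutes with the pointwise limit; the term
  \<open>\<i> * \<epsilon> * G\<close> vanishes because the regularised values converge.\<close>

lemma helmholtz_green:
  fixes m :: "int ^ 'd"
  assumes "h \<noteq> 0" and ex: "green_exists h k TYPE('d)"
  shows "discrete_helmholtz h k (green h k) m = (if m = 0 then 1 / of_real h ^ 2 else 0)"
proof -
  have lim: "((\<lambda>\<epsilon>. green_reg h k \<epsilon> n) \<longlongrightarrow> green h k n) (at_right 0)" for n :: "int ^ 'd"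
    using ex tendsto_Lim[OF trivial_limit_at_right_real] unfolding green_exists_def green_def by metis
  have "((\<lambda>\<epsilon>. discrete_helmholtz h k (green_reg h k \<epsilon>) m) \<longlongrightarrow>
      discrete_helmholtz h k (green h k) m) (at_right 0)"
    unfolding discrete_helmholtz_def by (intro tendsto_intros lim)
  moreover have "((\<lambda>\<epsilon>. discrete_helmholtz h k (green_reg h k \<epsilon>) m) \<longlongrightarrow>
      ((if m = 0 then 1 else 0) - \<i> * of_real 0 * green h k m) / of_real h ^ 2) (at_right 0)"
  proof (rule Lim_transform_eventually)
    show "((\<lambda>\<epsilon>. ((if m = 0 then 1 else 0) - \<i> * of_real \<epsilon> * green_reg h k \<epsilon> m) / of_real h ^ 2) \<longlongrightarrow>
        ((if m = 0 then 1 else 0) - \<i> * of_real 0 * green h k m) / of_real h ^ 2) (at_right 0)"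
      by (intro tendsto_intros lim) (use assms in auto)
    \<comment> \<open>The closed form is available for nonzero \<epsilon>, hence eventually to the
      right of 0.\<close>
    show "\<forall>\<^sub>F \<epsilon> in at_right 0. ((if m = 0 then 1 else 0) - \<i> * of_real \<epsilon> * green_reg h k \<epsilon> m) / of_real h ^ 2
        = discrete_helmholtz h k (green_reg h k \<epsilon>) m"
      using eventually_at_right_less[of 0] by eventually_elim (simp add: helmholtz_green_reg assms)
  qed
  ultimately show ?thesis
    using tendsto_unique[OF trivial_limit_at_right_real] by fastforce
qed

section \<open>Linearity, translation invariance and locality of the operator\<close>

lemma discrete_helmholtz_add:
  "discrete_helmholtz h k (\<lambda>m. u m + v m) m = discrete_helmholtz h k u m + discrete_helmholtz h k v m"
proof -
  have "(\<Sum>e\<in>unit_steps. u (m + e) + v (m + e) - (u m + v m)) =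
      (\<Sum>e\<in>unit_steps. u (m + e) - u m) + (\<Sum>e\<in>unit_steps. v (m + e) - v m)"
    by (simp only: sum.distrib[symmetric] add_diff_add)
  then show ?thesis
    by (simp only: discrete_helmholtz_def) (simp only: ring_distribs add_diff_add)
qed

lemma discrete_helmholtz_mult:
  "discrete_helmholtz h k (\<lambda>m. c * v m) m = c * discrete_helmholtz h k v m"
proof -
  have "(\<Sum>e\<in>unit_steps. c * v (m + e) - c * v m) = c * (\<Sum>e\<in>unit_steps. v (m + e) - v m)"
    by (simp only: sum_distrib_left right_diff_distrib)
  then show ?thesis
    by (simp only: discrete_helmholtz_def) (simp only: right_diff_distrib mult.left_commute)
qed

lemma discrete_helmholtz_diff:
  "discrete_helmholtz h k (\<lambda>m. u m - v m) m = discrete_helmholtz h k u m - discrete_helmholtz h k v m"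
  using discrete_helmholtz_add[of h k u "\<lambda>m. - 1 * v m" m] discrete_helmholtz_mult[of h k "-1" v m]
  by simp

lemma discrete_helmholtz_zero [simp]: "discrete_helmholtz h k (\<lambda>_. 0) m = 0"
  by (simp add: discrete_helmholtz_def)

lemma discrete_helmholtz_sum:
  "discrete_helmholtz h k (\<lambda>m. \<Sum>n\<in>S. c n * v n m) m = (\<Sum>n\<in>S. c n * discrete_helmholtz h k (v n) m)"
  by (induction S rule: infinite_finite_induct)
    (simp_all add: discrete_helmholtz_add discrete_helmholtz_mult)

lemma discrete_helmholtz_shift:
  "discrete_helmholtz h k (\<lambda>m. v (n + m)) m = discrete_helmholtz h k v (n + m)"
  by (simp add: discrete_helmholtz_def add.assoc)

text \<open>Locality, phrased for a whole set of centres because it is applied to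
  \<open>M_plus\<close> and to complements as well as to the single centre 0.\<close>

lemma discrete_helmholtz_cong:
  assumes "m \<in> M" "\<And>n. n \<in> stencil_nodes M \<Longrightarrow> u n = v n"
  shows "discrete_helmholtz h k u m = discrete_helmholtz h k v m"
  using assms unfolding discrete_helmholtz_def stencil_nodes_def
  by (intro arg_cong2[where f="(-)"] arg_cong2[where f="(*)"] sum.cong refl) auto

lemma finitely_supported_mult_right:
  "finitely_supported u \<Longrightarrow> finitely_supported (\<lambda>m. u m * v m)"
  unfolding finitely_supported_def by (rule finite_subset[of _ "{m. u m \<noteq> 0}"]) auto

lemma finite_support_shift:
  assumes "finitely_supported v"
  shows "finite {m. v (m + e) \<noteq> 0}"
proof -
  have "{m. v (m + e) \<noteq> 0} \<subseteq> (\<lambda>n. n - e) ` {m. v m \<noteq> 0}" by force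
  then show ?thesis using assms unfolding finitely_supported_def by (metis finite_imageI finite_subset)
qed

text \<open>The superset is explicit because it later serves as an index set of summation; it also
  contains the support of every translate of \<open>v\<close> by a stencil node.\<close>

lemma helmholtz_support:
  fixes v :: "int ^ 'd \<Rightarrow> complex"
  shows "{m. discrete_helmholtz h k v m \<noteq> 0} \<subseteq> (\<Union>e\<in>stencil_nodes {0}. {m. v (m + e) \<noteq> 0})"
proof
  fix m assume m: "m \<in> {m. discrete_helmholtz h k v m \<noteq> 0}"
  show "m \<in> (\<Union>e\<in>stencil_nodes {0}. {m. v (m + e) \<noteq> 0})"
  proof (rule ccontr)
    assume "\<not> ?thesis"
    then have "v (m + e) = 0" if "e \<in> stencil_nodes {0}" for e using that by blast
    then have "discrete_helmholtz h k (\<lambda>e. v (m + e)) 0 = discrete_helmholtz h k (\<lambda>_. 0) (0 :: int ^ 'd)"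
      by (intro discrete_helmholtz_cong[of _ "{0}"]) auto
    then show False using m by (simp add: discrete_helmholtz_shift)
  qed
qed

lemma finite_support_stencil:
  "finitely_supported v \<Longrightarrow> finite (\<Union>e\<in>stencil_nodes {0}. {m. v (m + e) \<noteq> 0})"
  by (simp add: finite_support_shift finite_stencil_nodes)

lemma finitely_supported_helmholtz:
  "finitely_supported v \<Longrightarrow> finitely_supported (discrete_helmholtz h k v)"
  unfolding finitely_supported_def[of "discrete_helmholtz h k v"]
  by (rule finite_subset[OF helmholtz_support finite_support_stencil])

section \<open>Convolution with the Green's function inverts the operator\<close>

text \<open>Terms outside the support vanish, so convolutions of different functions can be summed
  over one common finite set.\<close>

lemma green_conv_eq:
  assumes "finite S" "{n. f n \<noteq> 0} \<subseteq> S"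
  shows "green_conv h k f m = of_real h ^ 2 * (\<Sum>n\<in>S. green h k (m - n) * f n)"
  unfolding green_conv_def using assms by (intro arg_cong2[where f="(*)"] sum.mono_neutral_left) auto

lemma green_conv_diff:
  assumes "finitely_supported f" "finitely_supported g"
  shows "green_conv h k (\<lambda>n. f n - g n) m = green_conv h k f m - green_conv h k g m"
proof -
  let ?S = "{n. f n \<noteq> 0} \<union> {n. g n \<noteq> 0}"
  have S: "finite ?S" using assms by (simp add: finitely_supported_def)
  show ?thesis
    by (subst (1 2 3) green_conv_eq[OF S]) (auto simp: algebra_simps sum_subtractf)
qed

lemma helmholtz_green_conv:
  fixes f :: "int ^ 'd \<Rightarrow> complex"
  assumes "h \<noteq> 0" "green_exists h k TYPE('d)" "finitely_supported f"
  shows "discrete_helmholtz h k (green_conv h k f) m = f m"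
proof -
  let ?S = "{n. f n \<noteq> 0}"
  have fin: "finite ?S" using assms by (simp add: finitely_supported_def)
  \<comment> \<open>The argument is written \<open>- n + m\<close> to match the form of
    \<open>discrete_helmholtz_shift\<close>.\<close>
  have "green_conv h k f = (\<lambda>m. \<Sum>n\<in>?S. (of_real h ^ 2 * f n) * green h k (- n + m))"
    by (simp add: fun_eq_iff green_conv_def sum_distrib_left mult_ac)
  then have "discrete_helmholtz h k (green_conv h k f) m =
      (\<Sum>n\<in>?S. (of_real h ^ 2 * f n) * discrete_helmholtz h k (green h k) (- n + m))"
    by (simp only: discrete_helmholtz_sum discrete_helmholtz_shift)
  also have "\<dots> = (\<Sum>n\<in>?S. if n = m then f n else 0)"
    using assms by (intro sum.cong refl) (simp add: helmholtz_green)
  also have "\<dots> = f m" using fin by simp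
  finally show ?thesis .
qed

lemma green_conv_shift:
  "green_conv h k (\<lambda>n. f (n + e)) m = green_conv h k f (m + e)"
proof -
  have "(\<Sum>n | f (n + e) \<noteq> 0. green h k (m - n) * f (n + e)) = (\<Sum>n | f n \<noteq> 0. green h k (m + e - n) * f n)"
    by (rule sum.reindex_bij_witness[of _ "\<lambda>n. n - e" "\<lambda>n. n + e"]) auto
  then show ?thesis by (simp add: green_conv_def)
qed

text \<open>
  By translation invariance \<open>(G \<ast> L f) m\<close> is the operator applied to \<open>e \<mapsto> (G \<ast> f) (m + e)\<close> at \<open>0\<close>; the
  proof fixes one finite index set that serves all translates of \<open>f\<close> in the stencil.
\<close>

lemma green_conv_helmholtz:
  fixes f :: "int ^ 'd \<Rightarrow> complex"
  assumes "h \<noteq> 0" "green_exists h k TYPE('d)" and f: "finitely_supported f"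
  shows "green_conv h k (discrete_helmholtz h k f) m = f m"
proof -
  let ?S = "\<Union>e\<in>stencil_nodes {0}. {n. f (n + e) \<noteq> 0}"
  \<comment> \<open>The argument \<open>n + 0\<close> is what
    \<open>discrete_helmholtz_shift\<close> produces for the translate
    \<open>\<lambda>e. f (n + e)\<close> at 0.\<close>
  have "green_conv h k (discrete_helmholtz h k f) m =
      (\<Sum>n\<in>?S. (of_real h ^ 2 * green h k (m - n)) * discrete_helmholtz h k f (n + 0))"
    by (subst green_conv_eq[OF finite_support_stencil[OF f] helmholtz_support])
      (simp add: sum_distrib_left mult.assoc)
  also have "\<dots> = discrete_helmholtz h k (\<lambda>e. \<Sum>n\<in>?S. (of_real h ^ 2 * green h k (m - n)) * f (n + e)) 0"
    by (simp only: discrete_helmholtz_sum discrete_helmholtz_shift)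
  also have "\<dots> = discrete_helmholtz h k (\<lambda>e. green_conv h k f (m + e)) 0"
  proof (rule discrete_helmholtz_cong[of _ "{0}"])
    fix e :: "int ^ 'd" assume "e \<in> stencil_nodes {0}"
    then have "{n. f (n + e) \<noteq> 0} \<subseteq> ?S" by blast
    then have "green_conv h k (\<lambda>n. f (n + e)) m = of_real h ^ 2 * (\<Sum>n\<in>?S. green h k (m - n) * f (n + e))"
      by (rule green_conv_eq[OF finite_support_stencil[OF f]])
    then show "(\<Sum>n\<in>?S. (of_real h ^ 2 * green h k (m - n)) * f (n + e)) = green_conv h k f (m + e)"
      by (simp add: green_conv_shift sum_distrib_left mult.assoc)
  qed simp
  also have "\<dots> = f m"
    by (simp add: discrete_helmholtz_shift helmholtz_green_conv[OF assms])
  finally show ?thesis .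
qed

section \<open>Truncation, potentials and their uniqueness\<close>

text \<open>Stencils centred in \<open>M\<close> are untouched by the cut. In a stencil centred off
  \<open>M\<close>, each node is either cut to zero or lies in the overlap, where \<open>v\<close>
  vanishes.\<close>

lemma helmholtz_truncate:
  assumes "\<And>m. m \<in> stencil_nodes M \<inter> stencil_nodes (- M) \<Longrightarrow> v m = 0"
  shows "discrete_helmholtz h k (\<lambda>n. v n * indicator (stencil_nodes M) n) m =
    discrete_helmholtz h k v m * indicator M m"
proof (cases "m \<in> M")
  case True
  then show ?thesis by (simp, intro discrete_helmholtz_cong) auto
next
  case False
  have "discrete_helmholtz h k (\<lambda>n. v n * indicator (stencil_nodes M) n) m =
      discrete_helmholtz h k (\<lambda>_. 0) m"
    using False assms by (intro discrete_helmholtz_cong[of _ "- M"]) (auto simp: indicator_def)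
  then show ?thesis using False by (simp add: discrete_helmholtz_def)
qed

text \<open>The closure of an open set is the set together with its frontier, and the frontier
  contains no node.\<close>

lemma M_minus_eq:
  assumes "open \<Omega>" "\<And>m. node h m \<notin> frontier \<Omega>"
  shows "M_minus h \<Omega> = - M_plus h \<Omega>"
  using assms closure_subset[of \<Omega>] by (auto simp: M_minus_def M_plus_def frontier_def interior_open)

lemma admissible_extension_strip:
  "admissible_extension h k \<Omega> \<xi> V \<Longrightarrow> m \<in> boundary_strip h \<Omega> \<Longrightarrow> V m = \<xi> m"
  unfolding admissible_extension_def by blast

lemma admissible_extension_finite:
  "admissible_extension h k \<Omega> \<xi> V \<Longrightarrow> finitely_supported (discrete_helmholtz h k V)"
  unfolding admissible_extension_def by blast

text \<open>A finitely supported extension is reproduced by \<open>green_conv_helmholtz\<close>;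
  otherwise the identity is the second alternative of admissibility.\<close>

lemma admissible_extension_helmholtz:
  fixes \<Omega> :: "(real ^ 'd) set"
  assumes "h \<noteq> 0" "green_exists h k TYPE('d)" "admissible_extension h k \<Omega> \<xi> V"
  shows "green_conv h k (discrete_helmholtz h k V) = V"
proof (cases "finitely_supported V")
  case True
  show ?thesis by (rule ext) (rule green_conv_helmholtz[OF assms(1,2) True])
next
  case False
  then show ?thesis using assms(3) unfolding admissible_extension_def by argo
qed

text \<open>The full source reproduces \<open>V\<close>, so removing its part in
  \<open>M_plus\<close> leaves the part in \<open>M_minus\<close>.\<close>

lemma potential_eq_green_conv_minus:
  fixes \<Omega> :: "(real ^ 'd) set"
  assumes "h \<noteq> 0" "green_exists h k TYPE('d)" "admissible_extension h k \<Omega> \<xi> V"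
    and M: "M_minus h \<Omega> = - M_plus h \<Omega>"
  shows "potential h k \<Omega> V = green_conv h k (\<lambda>n. discrete_helmholtz h k V n * indicator (M_minus h \<Omega>) n)"
proof
  fix m
  let ?f = "discrete_helmholtz h k V"
  have "finitely_supported ?f" using assms(3) by (rule admissible_extension_finite)
  moreover have "?f n * indicator (M_minus h \<Omega>) n = ?f n - ?f n * indicator (M_plus h \<Omega>) n" for n
    by (simp add: M indicator_def)
  ultimately have "green_conv h k (\<lambda>n. ?f n * indicator (M_minus h \<Omega>) n) m =
      green_conv h k ?f m - green_conv h k (\<lambda>n. ?f n * indicator (M_plus h \<Omega>) n) m"
    by (simp add: green_conv_diff finitely_supported_mult_right)
  then show "potential h k \<Omega> V m = green_conv h k (\<lambda>n. ?f n * indicator (M_minus h \<Omega>) n) m"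
    by (simp add: potential_def admissible_extension_helmholtz[OF assms(1-3)])
qed

lemma helmholtz_potential:
  fixes \<Omega> :: "(real ^ 'd) set"
  assumes "h \<noteq> 0" "green_exists h k TYPE('d)" "admissible_extension h k \<Omega> \<xi> V" "m \<in> M_plus h \<Omega>"
  shows "discrete_helmholtz h k (potential h k \<Omega> V) m = 0"
  unfolding potential_def using admissible_extension_finite[OF assms(3)] assms(1,2,4)
  by (simp add: discrete_helmholtz_diff helmholtz_green_conv finitely_supported_mult_right)

text \<open>Agreement is established on all of \<open>N_plus\<close>, since the reconstruction of a
  solution needs more than its values on the strip.\<close>

lemma potential_unique:
  fixes \<Omega> :: "(real ^ 'd) set"
  assumes "h > 0" "green_exists h k TYPE('d)" "bounded \<Omega>" and M: "M_minus h \<Omega> = - M_plus h \<Omega>"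
    and V: "admissible_extension h k \<Omega> \<xi> V" and V': "admissible_extension h k \<Omega> \<xi> V'"
    and m: "m \<in> N_plus h \<Omega>"
  shows "potential h k \<Omega> V m = potential h k \<Omega> V' m"
proof -
  let ?L = "discrete_helmholtz h k" and ?\<chi> = "indicator (M_plus h \<Omega>) :: int ^ 'd \<Rightarrow> complex"
  define W where "W n = V n - V' n" for n
  let ?W = "\<lambda>n. W n * indicator (N_plus h \<Omega>) n"
  have fin: "finitely_supported (?L V)" "finitely_supported (?L V')"
    using admissible_extension_finite[OF V] admissible_extension_finite[OF V'] .
  have "finite (N_plus h \<Omega>)"
    unfolding N_plus_def using assms by (intro finite_stencil_nodes finite_M_plus)
  \<comment> \<open>The extensions may have infinite support; the cut to the finite set
    \<open>N_plus\<close> makes \<open>green_conv_helmholtz\<close> applicable.\<close>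
  then have "finitely_supported ?W"
    unfolding finitely_supported_def by (rule finite_subset[rotated]) (auto simp: indicator_def)
  then have "?W m = green_conv h k (?L ?W) m"
    using assms by (simp add: green_conv_helmholtz)
  also have "?L ?W = (\<lambda>n. ?L W n * ?\<chi> n)"
    unfolding N_plus_def
    using admissible_extension_strip[OF V] admissible_extension_strip[OF V']
    by (intro ext helmholtz_truncate) (simp add: W_def boundary_strip_def N_plus_def N_minus_def M)
  also have "\<dots> = (\<lambda>n. ?L V n * ?\<chi> n - ?L V' n * ?\<chi> n)"
    by (simp add: W_def[abs_def] discrete_helmholtz_diff algebra_simps)
  also have "green_conv h k \<dots> m = green_conv h k (\<lambda>n. ?L V n * ?\<chi> n) m - green_conv h k (\<lambda>n. ?L V' n * ?\<chi> n) m"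
    using fin by (intro green_conv_diff finitely_supported_mult_right)
  finally show ?thesis using m by (simp add: potential_def W_def algebra_simps)
qed

text \<open>The zero extension of \<open>u\<close> has no source in \<open>M_plus\<close>, so it is
  its own potential; \<open>potential_unique\<close> carries this over to any
  \<open>V\<close>.\<close>

lemma potential_eq_solution:
  fixes \<Omega> :: "(real ^ 'd) set"
  assumes "h > 0" "green_exists h k TYPE('d)" "bounded \<Omega>" "M_minus h \<Omega> = - M_plus h \<Omega>"
    and V: "admissible_extension h k \<Omega> \<xi> V"
    and u: "\<And>m. m \<in> M_plus h \<Omega> \<Longrightarrow> discrete_helmholtz h k u m = 0"
    and u\<gamma>: "\<And>m. m \<in> boundary_strip h \<Omega> \<Longrightarrow> u m = \<xi> m"
    and m: "m \<in> N_plus h \<Omega>"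
  shows "potential h k \<Omega> V m = u m"
proof -
  let ?U = "\<lambda>n. u n * indicator (N_plus h \<Omega>) n"
  have "finite (N_plus h \<Omega>)"
    unfolding N_plus_def using assms by (intro finite_stencil_nodes finite_M_plus)
  then have "finitely_supported ?U"
    unfolding finitely_supported_def by (rule finite_subset[rotated]) (auto simp: indicator_def)
  then have "admissible_extension h k \<Omega> \<xi> ?U"
    using u\<gamma> by (simp add: admissible_extension_def finitely_supported_helmholtz boundary_strip_def)
  then have "potential h k \<Omega> V m = potential h k \<Omega> ?U m"
    using assms by (intro potential_unique)
  moreover have "discrete_helmholtz h k ?U n = discrete_helmholtz h k u n" if "n \<in> M_plus h \<Omega>" for n
    using that by (intro discrete_helmholtz_cong) (auto simp: N_plus_def)
  then have "(\<lambda>n. discrete_helmholtz h k ?U n * indicator (M_plus h \<Omega>) n) = (\<lambda>_. 0)"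
    using u by (auto simp: fun_eq_iff indicator_def)
  ultimately show ?thesis using m by (simp add: potential_def green_conv_def)
qed

theorem theorem3p2:
  fixes h k :: real and \<Omega> :: "(real ^ 'd) set"
  assumes dim: "CARD('d) \<in> {2, 3}"
    and "h > 0" and "k > 0"
    and "lipschitz_domain \<Omega>" and "bounded \<Omega>"
    and no_boundary_node: "\<And>m. node h m \<notin> frontier \<Omega>"
    and "green_exists h k TYPE('d)"
    and "nonresonant h k \<Omega>"
  defines "\<gamma> \<equiv> boundary_strip h \<Omega>"
    and "P \<equiv> potential h k \<Omega>"
    and "P\<^sub>\<gamma> \<equiv> boundary_projection h k \<Omega>"
  shows
    "(\<forall>\<xi> \<in> \<gamma> \<rightarrow>\<^sub>E UNIV. \<forall>V. admissible_extension h k \<Omega> \<xi> V \<longrightarrow>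
        P V = green_conv h k (\<lambda>n. discrete_helmholtz h k V n * indicator (M_minus h \<Omega>) n)) \<and>
     (\<forall>\<xi> \<in> \<gamma> \<rightarrow>\<^sub>E UNIV. \<forall>V V'. admissible_extension h k \<Omega> \<xi> V \<and> admissible_extension h k \<Omega> \<xi> V' \<longrightarrow>
        restrict (P V) \<gamma> = restrict (P V') \<gamma>) \<and>
     (\<forall>\<xi> \<in> \<gamma> \<rightarrow>\<^sub>E UNIV. P\<^sub>\<gamma> (P\<^sub>\<gamma> \<xi>) = P\<^sub>\<gamma> \<xi>) \<and>
     (\<forall>\<xi> \<in> \<gamma> \<rightarrow>\<^sub>E UNIV.
        (\<xi> \<in> P\<^sub>\<gamma> ` (\<gamma> \<rightarrow>\<^sub>E UNIV) \<longleftrightarrow>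
           (\<exists>u \<in> N_plus h \<Omega> \<rightarrow>\<^sub>E UNIV.
              (\<forall>m \<in> M_plus h \<Omega>. discrete_helmholtz h k u m = 0) \<and> restrict u \<gamma> = \<xi>)) \<and>
        (\<forall>u \<in> N_plus h \<Omega> \<rightarrow>\<^sub>E UNIV.
           (\<forall>m \<in> M_plus h \<Omega>. discrete_helmholtz h k u m = 0) \<and> restrict u \<gamma> = \<xi> \<longrightarrow>
           (\<forall>V. admissible_extension h k \<Omega> \<xi> V \<longrightarrow> restrict (P V) (N_plus h \<Omega>) = u)))"
proof -
  have h: "h \<noteq> 0" using \<open>h > 0\<close> by simp
  have "open \<Omega>"
    using \<open>lipschitz_domain \<Omega>\<close> unfolding lipschitz_domain_def by (rule conjunct1)
  then have M: "M_minus h \<Omega> = - M_plus h \<Omega>"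
    using no_boundary_node by (rule M_minus_eq)
  have \<gamma>N: "\<gamma> \<subseteq> N_plus h \<Omega>" by (auto simp: \<gamma>_def boundary_strip_def)
  have solution: "P V m = u m"
    if "admissible_extension h k \<Omega> \<xi> V" "\<forall>m \<in> M_plus h \<Omega>. discrete_helmholtz h k u m = 0"
      "restrict u \<gamma> = \<xi>" "m \<in> N_plus h \<Omega>" for \<xi> V u m
    unfolding P_def
  proof (rule potential_eq_solution[OF \<open>h > 0\<close> \<open>green_exists h k TYPE('d)\<close> \<open>bounded \<Omega>\<close> M that(1)])
    show "u m = \<xi> m" if "m \<in> boundary_strip h \<Omega>" for m
      unfolding \<open>restrict u \<gamma> = \<xi>\<close>[symmetric] using that by (simp add: \<gamma>_def)
  qed (use that in auto)
  \<comment> \<open>The choice in the projection is unpacked once; existence of an extension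
    guarantees that the chosen one is admissible.\<close>
  have P\<gamma>: "\<exists>V. admissible_extension h k \<Omega> \<xi> V \<and> P\<^sub>\<gamma> \<xi> = restrict (P V) \<gamma>" for \<xi>
    unfolding P\<^sub>\<gamma>_def boundary_projection_def P_def \<gamma>_def
    using someI_ex[OF admissible_extension_exists[OF \<open>h > 0\<close> \<open>bounded \<Omega>\<close>]] by blast
  have P\<gamma>_trace: "P\<^sub>\<gamma> \<xi> = \<xi>"
    if "\<forall>m \<in> M_plus h \<Omega>. discrete_helmholtz h k u m = 0" "restrict u \<gamma> = \<xi>" for u \<xi>
  proof -
    obtain V where V: "admissible_extension h k \<Omega> \<xi> V" "P\<^sub>\<gamma> \<xi> = restrict (P V) \<gamma>" using P\<gamma> by blast
    have "P V m = u m" if "m \<in> \<gamma>" for m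
      using solution[OF V(1) \<open>\<forall>m \<in> M_plus h \<Omega>. _\<close> \<open>restrict u \<gamma> = \<xi>\<close>] \<gamma>N that by blast
    then have "P\<^sub>\<gamma> \<xi> = restrict u \<gamma>" unfolding V(2) by (rule restrict_ext)
    then show ?thesis using that(2) by simp
  qed
  have trace: "\<exists>u \<in> N_plus h \<Omega> \<rightarrow>\<^sub>E UNIV.
      (\<forall>m \<in> M_plus h \<Omega>. discrete_helmholtz h k u m = 0) \<and> restrict u \<gamma> = P\<^sub>\<gamma> \<xi>" for \<xi>
  proof -
    obtain V where V: "admissible_extension h k \<Omega> \<xi> V" "P\<^sub>\<gamma> \<xi> = restrict (P V) \<gamma>" using P\<gamma> by blast
    let ?u = "restrict (P V) (N_plus h \<Omega>)"
    \<comment> \<open>Restriction makes values off \<open>N_plus\<close> undefined, but stencils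
      centred in \<open>M_plus\<close> never reach them.\<close>
    have "discrete_helmholtz h k ?u m = discrete_helmholtz h k (P V) m" if "m \<in> M_plus h \<Omega>" for m
      using that by (intro discrete_helmholtz_cong) (auto simp: N_plus_def)
    then have "\<forall>m \<in> M_plus h \<Omega>. discrete_helmholtz h k ?u m = 0"
      using helmholtz_potential[OF h \<open>green_exists h k TYPE('d)\<close> V(1)] by (simp add: P_def)
    moreover have "restrict ?u \<gamma> = P\<^sub>\<gamma> \<xi>"
      unfolding V(2) using \<gamma>N by (intro restrict_ext) auto
    ultimately show ?thesis by (intro bexI[of _ ?u]) auto
  qed
  have representation: "P V = green_conv h k (\<lambda>n. discrete_helmholtz h k V n * indicator (M_minus h \<Omega>) n)"
    if "admissible_extension h k \<Omega> \<xi> V" for \<xi> V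
    unfolding P_def using h \<open>green_exists h k TYPE('d)\<close> that M by (rule potential_eq_green_conv_minus)
  have independent: "restrict (P V) \<gamma> = restrict (P V') \<gamma>"
    if "admissible_extension h k \<Omega> \<xi> V" "admissible_extension h k \<Omega> \<xi> V'" for \<xi> V V'
    unfolding P_def
  proof (rule restrict_ext)
    show "potential h k \<Omega> V m = potential h k \<Omega> V' m" if "m \<in> \<gamma>" for m
      using \<gamma>N that
      by (intro potential_unique[OF \<open>h > 0\<close> \<open>green_exists h k TYPE('d)\<close> \<open>bounded \<Omega>\<close> M
            \<open>admissible_extension h k \<Omega> \<xi> V\<close> \<open>admissible_extension h k \<Omega> \<xi> V'\<close>]) auto
  qed
  \<comment> \<open>A projected density is the trace of a solution, and such traces are fixed
    points.\<close>
  have idempotent: "P\<^sub>\<gamma> (P\<^sub>\<gamma> \<xi>) = P\<^sub>\<gamma> \<xi>" for \<xi>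
    using trace[of \<xi>] P\<gamma>_trace by blast
  have image: "\<xi> \<in> P\<^sub>\<gamma> ` (\<gamma> \<rightarrow>\<^sub>E UNIV) \<longleftrightarrow>
      (\<exists>u \<in> N_plus h \<Omega> \<rightarrow>\<^sub>E UNIV.
        (\<forall>m \<in> M_plus h \<Omega>. discrete_helmholtz h k u m = 0) \<and> restrict u \<gamma> = \<xi>)"
    if "\<xi> \<in> \<gamma> \<rightarrow>\<^sub>E UNIV" for \<xi>
  proof
    assume "\<xi> \<in> P\<^sub>\<gamma> ` (\<gamma> \<rightarrow>\<^sub>E UNIV)"
    then obtain \<eta> where "\<xi> = P\<^sub>\<gamma> \<eta>" by blast
    with trace[of \<eta>] show "\<exists>u \<in> N_plus h \<Omega> \<rightarrow>\<^sub>E UNIV.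
        (\<forall>m \<in> M_plus h \<Omega>. discrete_helmholtz h k u m = 0) \<and> restrict u \<gamma> = \<xi>"
      by (simp only:)
  next
    assume "\<exists>u \<in> N_plus h \<Omega> \<rightarrow>\<^sub>E UNIV.
        (\<forall>m \<in> M_plus h \<Omega>. discrete_helmholtz h k u m = 0) \<and> restrict u \<gamma> = \<xi>"
    then have "P\<^sub>\<gamma> \<xi> = \<xi>" using P\<gamma>_trace by blast
    then show "\<xi> \<in> P\<^sub>\<gamma> ` (\<gamma> \<rightarrow>\<^sub>E UNIV)" using that by (metis image_eqI)
  qed
  have reconstruction: "restrict (P V) (N_plus h \<Omega>) = u"
    if "u \<in> N_plus h \<Omega> \<rightarrow>\<^sub>E UNIV" "\<forall>m \<in> M_plus h \<Omega>. discrete_helmholtz h k u m = 0"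
      "restrict u \<gamma> = \<xi>" "admissible_extension h k \<Omega> \<xi> V" for u \<xi> V
  proof -
    have "restrict (P V) (N_plus h \<Omega>) = restrict u (N_plus h \<Omega>)"
      by (rule restrict_ext) (rule solution[OF that(4,2,3)])
    \<comment> \<open>Extensionality of \<open>u\<close> turns agreement on \<open>N_plus\<close>
      into equality of functions.\<close>
    also have "\<dots> = u" using that(1) by (rule PiE_restrict)
    finally show ?thesis .
  qed
  show ?thesis
    by (intro conjI ballI allI impI; (elim conjE)?)
      (rule representation independent idempotent image reconstruction; assumption)+
qed

end
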